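(* Let $G=(V,E)$ be the double banana graph, i.e. the simple graph with the $8$ vertices $r_1,r_2,a_1,b_1,c_1,a_2,b_2,c_2$ and the $18$ edges $$r_i a_j,\quad r_i b_j,\quad r_i c_j \quad (i,j\in\{1,2\}), \qquad a_jb_j,\quad a_jc_j,\quad b_jc_j \quad (j\in\{1,2\}).$$ Then for every edge $e\in E$ there exists a partition $(S_1,S_2,S_3)$ of $E$ such that: (1) $|S_i|=|V|-i$ for each $i\in\{1,2,3\}$; (2) $e\in S_1$; (3) each of the graphs $(V,S_1\cup S_2)$, $(V,S_1\cup S_3)/e$ and $(V,S_2\cup S_3\cup\{e\})/e$ is minimally $2$-rigid. However, $G$ is not $3$-rigid. Consequently, the following statement is false: "every graph $G=(V,E)$ with at least $4$ vertices such that for every edge $e\in E$ there is a partition $(S_1,S_2,S_3)$ of $E$ satisfying (1), (2) and (3) is minimally $3$-rigid".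
   Context: Graphs are finite and simple. For a graph $G=(V,E)$ and a map $p:V\to\mathbb{R}^d$ (a $d$-dimensional realisation, $p(v)=(p_1(v),\dots,p_d(v))$), the rigidity matrix $R(G,p)$ is the $|E|\times d|V|$ real matrix with rows indexed by edges and columns indexed by pairs $(v,i)\in V\times\{1,\dots,d\}$, whose entry in row $e$ and column $(v,i)$ is $p_i(v)-p_i(w)$ if $e=vw$, and $0$ if $v$ is not an endpoint of $e$. If $|V|\ge d$, the framework $(G,p)$ is infinitesimally rigid if $\operatorname{rank}R(G,p)=d|V|-\binom{d+1}{2}$; if $|V|<d$, it is infinitesimally rigid if $G$ is a complete graph and the points $p(v)$, $v\in V$, are affinely independent. The graph $G$ is $d$-rigid if there exists $p:V\to\mathbb{R}^d$ with $(G,p)$ infinitesimally rigid. It is minimally $d$-rigid if it is $d$-rigid but deleting any single edge yields a graph that is not $d$-rigid. For an edge $e=xy$ of a graph $H$, $H/e$ denotes the graph obtained from $H$ by contracting $e$: $e$ is removed, $x$ and $y$ are identified to a single vertex, and all other edges are kept. Saying that $H/e$ is minimally $2$-rigid includes that no two of the remaining edges become parallel, i.e. $H/e$ is a simple graph. *)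

theory Defs
  imports "HOL-Analysis.Analysis" "HOL-Library.Function_Algebras"
begin

(* Rows are functions 'c => real, a real vector space with the pointwise operations. *)
global_interpretation fun_space: vector_space "\<lambda>(k::real) (f :: 'c \<Rightarrow> real) x. k * f x"
  by unfold_locales (auto simp: fun_eq_iff algebra_simps)

(* Row rank, as in row_rank_def for real^'n^'m, but with rows indexed by the set I. *)
definition matrix_rank :: "'r set \<Rightarrow> ('r \<Rightarrow> 'c \<Rightarrow> real) \<Rightarrow> nat" where
  "matrix_rank I A = fun_space.dim (A ` I)"

type_synonym 'v graph = "'v set \<times> 'v set set"

definition simple_graph :: "'v graph \<Rightarrow> bool" where
  "simple_graph G \<longleftrightarrow> (case G of (V, E) \<Rightarrow>
     finite V \<and> (\<forall>e\<in>E. e \<subseteq> V \<and> card e = 2))"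

definition complete_graph :: "'v graph \<Rightarrow> bool" where
  "complete_graph G \<longleftrightarrow> (case G of (V, E) \<Rightarrow> E = {e. e \<subseteq> V \<and> card e = 2})"

(* Columns are indexed by 'v \<times> 'd; if E consists of edges on V, all columns (v, i) with
   v \<notin> V vanish, so that they do not affect the rank. *)
definition rigidity_matrix :: "('v \<Rightarrow> real^'d) \<Rightarrow> 'v set \<Rightarrow> 'v \<times> 'd \<Rightarrow> real" where
  "rigidity_matrix p e = (\<lambda>(v, i).
     if v \<in> e then p v $ i - p (THE w. e = {v, w}) $ i else 0)"

(* The dimension d is CARD('d). The subtraction on nat is not truncated, since
   card V \<ge> d implies d * card V \<ge> (d + 1) choose 2. Affine independence is that of the
   family p(v), v \<in> V, hence inj_on. *)
definition inf_rigid :: "'v graph \<Rightarrow> ('v \<Rightarrow> real^'d) \<Rightarrow> bool" where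
  "inf_rigid G p \<longleftrightarrow> (case G of (V, E) \<Rightarrow>
     if card V \<ge> CARD('d)
     then matrix_rank E (rigidity_matrix p) = CARD('d) * card V - ((CARD('d) + 1) choose 2)
     else complete_graph G \<and> inj_on p V \<and> \<not> affine_dependent (p ` V))"

definition rigid :: "'d::finite itself \<Rightarrow> 'v graph \<Rightarrow> bool" where
  "rigid (_ :: 'd itself) G \<longleftrightarrow> (\<exists>p :: 'v \<Rightarrow> real^'d. inf_rigid G p)"

definition minimally_rigid :: "'d::finite itself \<Rightarrow> 'v graph \<Rightarrow> bool" where
  "minimally_rigid d G \<longleftrightarrow> (case G of (V, E) \<Rightarrow>
     rigid d (V, E) \<and> (\<forall>e\<in>E. \<not> rigid d (V, E - {e})))"

(* The vertices of G/e are the classes of the partition of V that identifies the two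
   endpoints of e: the class e itself and the singletons {v} for v \<notin> e. *)
definition contract_vertex :: "'v set \<Rightarrow> 'v \<Rightarrow> 'v set" where
  "contract_vertex e v = (if v \<in> e then e else {v})"

definition contract :: "'v graph \<Rightarrow> 'v set \<Rightarrow> 'v set graph" where
  "contract G e = (case G of (V, E) \<Rightarrow>
     (contract_vertex e ` V, (\<lambda>f. contract_vertex e ` f) ` (E - {e})))"

(* contract records edges as a set and so merges parallel ones; injectivity says that
   there are none. Loops do not occur if G is simple. *)
definition contraction_minimally_rigid :: "'d::finite itself \<Rightarrow> 'v graph \<Rightarrow> 'v set \<Rightarrow> bool" where
  "contraction_minimally_rigid d G e \<longleftrightarrow>
     inj_on (\<lambda>f. contract_vertex e ` f) (snd G - {e}) \<and> minimally_rigid d (contract G e)"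

definition good_partition ::
    "'v graph \<Rightarrow> 'v set \<Rightarrow> 'v set set \<Rightarrow> 'v set set \<Rightarrow> 'v set set \<Rightarrow> bool" where
  "good_partition G e S1 S2 S3 \<longleftrightarrow> (case G of (V, E) \<Rightarrow>
     S1 \<union> S2 \<union> S3 = E \<and> S1 \<inter> S2 = {} \<and> S1 \<inter> S3 = {} \<and> S2 \<inter> S3 = {} \<and>
     card S1 = card V - 1 \<and> card S2 = card V - 2 \<and> card S3 = card V - 3 \<and>
     e \<in> S1 \<and>
     minimally_rigid TYPE(2) (V, S1 \<union> S2) \<and>
     contraction_minimally_rigid TYPE(2) (V, S1 \<union> S3) e \<and>
     contraction_minimally_rigid TYPE(2) (V, S2 \<union> S3 \<union> {e}) e)"

definition double_banana :: "(nat \<Rightarrow> 'v) \<Rightarrow> (nat \<Rightarrow> 'v) \<Rightarrow> (nat \<Rightarrow> 'v) \<Rightarrow> (nat \<Rightarrow> 'v) \<Rightarrow> 'v graph" where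
  "double_banana r a b c =
     ({r 1, r 2, a 1, b 1, c 1, a 2, b 2, c 2},
      (\<Union>i\<in>{1, 2}. \<Union>j\<in>{1, 2}. {{r i, a j}, {r i, b j}, {r i, c j}}) \<union>
      (\<Union>j\<in>{1, 2}. {{a j, b j}, {a j, c j}, {b j, c j}}))"

end

theory Submission
  imports Defs
begin

text \<open>The partitions are chosen such that all three graphs arise from a single edge by Henneberg
  0-extensions (adding a vertex of degree two). With the vertices placed on a parabola no three
  points are collinear, so each such extension keeps the rows of the rigidity matrix independent.
  By symmetry it suffices to treat the edges \<open>r1a1\<close> and \<open>a1b1\<close>. As 18 = 3 * 8 - 6, the double
  banana would be 3-rigid only with independent rows, but every realisation has a nonzero stress,
  obtained by combining the stresses of two copies of \<open>K\<^sub>5\<close>.\<close>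

section \<open>Row rank and linear independence of rows\<close>

text \<open>Independence of the family of rows, not of their set, so two equal rows are already
  dependent. The coefficients sit on the edges, which makes a relation a stress when
  \<open>A\<close> is a rigidity matrix.\<close>

definition independent_rows :: "'r set \<Rightarrow> ('r \<Rightarrow> 'c \<Rightarrow> real) \<Rightarrow> bool" where
  "independent_rows I A \<longleftrightarrow>
     (\<forall>g. (\<forall>x. (\<Sum>e\<in>I. g e * A e x) = 0) \<longrightarrow> (\<forall>e\<in>I. g e = 0))"

lemma sum_apply: "(\<Sum>i\<in>I. f i) x = (\<Sum>i\<in>I. f i x)" for f :: "'i \<Rightarrow> 'c \<Rightarrow> real"
  by (induction I rule: infinite_finite_induct) auto

lemma matrix_rank_le_card:
  assumes "finite I"
  shows "matrix_rank I A \<le> card I"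
proof -
  have "fun_space.dim (A ` I) \<le> card (A ` I)"
    using assms by (intro fun_space.dim_le_card fun_space.span_superset) auto
  then show ?thesis
    unfolding matrix_rank_def using card_image_le[OF assms] by (rule le_trans)
qed

text \<open>Independence of the family makes \<open>A\<close> injective on \<open>I\<close>, so the
  set of rows is independent and has \<open>card I\<close> elements.\<close>

lemma matrix_rank_independent_rows:
  assumes "finite I" and ind: "independent_rows I A"
  shows "matrix_rank I A = card I"
proof -
  have inj: "inj_on A I"
  proof (rule inj_onI, rule ccontr)
    fix e f assume ef: "e \<in> I" "f \<in> I" "A e = A f" "e \<noteq> f"
    \<comment> \<open>Two equal rows satisfy the relation with coefficients 1 and -1.\<close>
    let ?g = "\<lambda>h. (if h = e then 1 else 0) - (if h = f then 1 else 0) :: real"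
    have "(\<Sum>h\<in>I. ?g h * A h x) = 0" for x
    proof -
      have "(\<Sum>h\<in>I. ?g h * A h x)
          = (\<Sum>h\<in>I. if h = e then A h x else 0) - (\<Sum>h\<in>I. if h = f then A h x else 0)"
        unfolding sum_subtractf[symmetric] by (rule sum.cong) auto
      then show ?thesis using ef assms(1) by simp
    qed
    then have "?g e = 0" using ind[unfolded independent_rows_def, rule_format, of ?g e] ef(1) by simp
    then show False using ef by simp
  qed
  have "fun_space.independent (A ` I)"
    unfolding fun_space.dependent_finite[OF finite_imageI[OF assms(1)]]
  proof (clarify)
    fix u e
    assume e: "e \<in> I" "u (A e) \<noteq> 0"
      and "(\<Sum>v\<in>A ` I. (\<lambda>x. u v * v x)) = 0"
    then have "(\<Sum>e\<in>I. (\<lambda>x. u (A e) * A e x)) = 0"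
      by (simp add: sum.reindex[OF inj] o_def)
    then have "(\<Sum>e\<in>I. u (A e) * A e x) = 0" for x
      using sum_apply[of "\<lambda>e x. u (A e) * A e x" I x] by simp
    then show False
      using ind[unfolded independent_rows_def, rule_format, of "\<lambda>e. u (A e)"] e by simp
  qed
  then show ?thesis
    unfolding matrix_rank_def
    by (simp add: fun_space.dim_eq_card_independent card_image[OF inj])
qed

text \<open>A row with a nonzero coefficient in a relation lies in the span of the others, so fewer
  than \<open>card I\<close> rows would already generate the row space.\<close>

lemma independent_rows_if_matrix_rank:
  assumes "finite I" "matrix_rank I A = card I"
  shows "independent_rows I A"
  unfolding independent_rows_def
proof (intro allI impI ballI, rule ccontr)
  fix g e
  assume rel: "\<forall>x. (\<Sum>e\<in>I. g e * A e x) = 0" and e: "e \<in> I" "g e \<noteq> 0"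
  let ?J = "I - {e}"
  have "A e = (\<Sum>f\<in>?J. (\<lambda>x. (- g f / g e) * A f x))"
  proof
    fix x
    have "g e * A e x + (\<Sum>f\<in>?J. g f * A f x) = 0"
      using rel sum.remove[OF assms(1) e(1), of "\<lambda>f. g f * A f x"] by simp
    then have "A e x = - (\<Sum>f\<in>?J. g f * A f x) / g e"
      using e(2) by (simp add: field_simps)
    also have "\<dots> = (\<Sum>f\<in>?J. (- g f / g e) * A f x)"
      by (simp add: sum_divide_distrib flip: sum_negf)
    finally show "A e x = (\<Sum>f\<in>?J. (\<lambda>x. (- g f / g e) * A f x)) x"
      by (simp add: sum_apply)
  qed
  also have "\<dots> \<in> fun_space.span (A ` ?J)"
    by (intro fun_space.span_sum fun_space.span_scale fun_space.span_base) auto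
  finally have "A ` I \<subseteq> fun_space.span (A ` ?J)"
    by (auto intro: fun_space.span_base)
  then have "matrix_rank I A \<le> card (A ` ?J)"
    unfolding matrix_rank_def using assms(1) by (intro fun_space.dim_le_card) auto
  also have "\<dots> \<le> card ?J" using assms(1) by (intro card_image_le) auto
  also have "\<dots> < card I" using assms(1) e(1) by (rule card_Diff1_less)
  finally show False using assms(2) by simp
qed

text \<open>Eliminates the definite description, so that later proofs see only explicit
  entries.\<close>

lemma rigidity_matrix_doubleton:
  assumes "v \<noteq> w"
  shows "rigidity_matrix p {v, w} (x, i) =
    (if x = v then p v $ i - p w $ i else if x = w then p w $ i - p v $ i else 0)"
proof -
  have "(THE u. {v, w} = {v, u}) = w" "(THE u. {v, w} = {w, u}) = v"
    using assms by (auto simp: doubleton_eq_iff)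
  then show ?thesis by (auto simp: rigidity_matrix_def)
qed

lemma rigidity_matrix_notin: "x \<notin> e \<Longrightarrow> rigidity_matrix p e (x, i) = 0"
  by (simp add: rigidity_matrix_def)

subsection \<open>Henneberg 0-extensions\<close>

text \<open>A triple \<open>(x, y, z)\<close> adds the vertex \<open>x\<close> with the edges \<open>xy\<close> and \<open>xz\<close>;
  the head of the list is added last.\<close>

fun ext_verts :: "'a \<Rightarrow> 'a \<Rightarrow> ('a \<times> 'a \<times> 'a) list \<Rightarrow> 'a set" where
  "ext_verts u v [] = {u, v}"
| "ext_verts u v ((x, y, z) # xs) = insert x (ext_verts u v xs)"

fun ext_edges :: "'a \<Rightarrow> 'a \<Rightarrow> ('a \<times> 'a \<times> 'a) list \<Rightarrow> 'a set set" where
  "ext_edges u v [] = {{u, v}}"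
| "ext_edges u v ((x, y, z) # xs) = insert {x, y} (insert {x, z} (ext_edges u v xs))"

fun ext_ok :: "'a \<Rightarrow> 'a \<Rightarrow> ('a \<times> 'a \<times> 'a) list \<Rightarrow> bool" where
  "ext_ok u v [] \<longleftrightarrow> u \<noteq> v"
| "ext_ok u v ((x, y, z) # xs) \<longleftrightarrow> ext_ok u v xs \<and> x \<notin> ext_verts u v xs \<and>
     y \<in> ext_verts u v xs \<and> z \<in> ext_verts u v xs \<and> y \<noteq> z"

lemma finite_ext_verts: "finite (ext_verts u v xs)"
  and finite_ext_edges: "finite (ext_edges u v xs)"
  by (induction u v xs rule: ext_verts.induct) auto

lemma ext_edges_subset: "ext_ok u v xs \<Longrightarrow> e \<in> ext_edges u v xs \<Longrightarrow> e \<subseteq> ext_verts u v xs"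
  by (induction u v xs rule: ext_verts.induct) auto

lemma card_ext_verts: "ext_ok u v xs \<Longrightarrow> card (ext_verts u v xs) = length xs + 2"
  by (induction u v xs rule: ext_verts.induct) (auto simp: finite_ext_verts)

text \<open>The new edges contain \<open>x\<close>, which is not an old vertex, while old edges
  consist of old vertices.\<close>

lemma ext_new_edges:
  assumes "ext_ok u v ((x, y, z) # xs)"
  shows "{x, y} \<notin> ext_edges u v xs" "{x, z} \<notin> ext_edges u v xs" "{x, y} \<noteq> {x, z}"
    "x \<noteq> y" "x \<noteq> z"
  using assms ext_edges_subset[of u v xs] by (auto simp: doubleton_eq_iff)

text \<open>With \<open>length xs + 2\<close> vertices this is 2 |V| - 3, the rank required in the
  plane.\<close>

lemma card_ext_edges: "ext_ok u v xs \<Longrightarrow> card (ext_edges u v xs) = 2 * length xs + 1"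
proof (induction u v xs rule: ext_edges.induct)
  case (2 u v x y z xs)
  then show ?case using ext_new_edges[OF 2(2)] by (simp add: finite_ext_edges)
qed simp

text \<open>Subtracting \<open>x + z\<close> times the first equation from the second eliminates
  \<open>d\<close> and leaves \<open>c * (x - y) * (y - z)\<close>.\<close>

lemma parabola_not_collinear:
  fixes x y z c d :: real
  assumes "x \<noteq> y" "y \<noteq> z"
    and "c * (x - y) + d * (x - z) = 0" "c * (x\<^sup>2 - y\<^sup>2) + d * (x\<^sup>2 - z\<^sup>2) = 0"
  shows "c = 0"
proof -
  have "c * ((x - y) * (y - z))
      = (c * (x\<^sup>2 - y\<^sup>2) + d * (x\<^sup>2 - z\<^sup>2)) - (x + z) * (c * (x - y) + d * (x - z))"
    by (simp add: algebra_simps power2_eq_square)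
  then show ?thesis using assms by simp
qed

text \<open>In the columns of the last vertex \<open>x\<close> a relation involves only its two
  edges, whose directions are not parallel. Both coefficients vanish, and a relation among the old
  rows remains.\<close>

lemma independent_rows_ext:
  fixes p :: "'a \<Rightarrow> real^2"
  assumes "ext_ok u v xs" "inj_on t (ext_verts u v xs)"
    and p: "\<And>x. p x = vector [t x, (t x)\<^sup>2]"
  shows "independent_rows (ext_edges u v xs) (rigidity_matrix p)"
  using assms(1,2)
proof (induction u v xs rule: ext_edges.induct)
  case (1 u v)
  then have "u \<noteq> v" "t u \<noteq> t v" by auto
  then have "rigidity_matrix p {u, v} (u, 1) \<noteq> 0"
    by (simp add: rigidity_matrix_doubleton p)
  then show ?case by (auto simp: independent_rows_def)
next
  case (2 u v x y z xs)
  let ?F = "ext_edges u v xs"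
  note new = ext_new_edges[OF 2(2)]
  have IH: "independent_rows ?F (rigidity_matrix p)" using 2 by (auto simp: inj_on_def)
  have x: "x \<notin> ext_verts u v xs" using 2(2) by simp
  have t: "t x \<noteq> t y" "t x \<noteq> t z" "t y \<noteq> t z"
    using 2(2) inj_onD[OF 2(3)] new by auto
  show ?case unfolding independent_rows_def
  proof (intro allI impI)
    fix g assume "\<forall>q. (\<Sum>e\<in>ext_edges u v ((x, y, z) # xs). g e * rigidity_matrix p e q) = 0"
    then have "(\<Sum>e\<in>insert {x, y} (insert {x, z} ?F). g e * rigidity_matrix p e q) = 0" for q
      by (cases q) simp
    then have *: "g {x, y} * rigidity_matrix p {x, y} q + (g {x, z} * rigidity_matrix p {x, z} q
        + (\<Sum>e\<in>?F. g e * rigidity_matrix p e q)) = 0" for q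
      using new by (simp add: finite_ext_edges)
    have "(\<Sum>e\<in>?F. g e * rigidity_matrix p e (x, i)) = 0" for i
    proof (intro sum.neutral ballI)
      fix e assume "e \<in> ?F"
      then have "x \<notin> e" using ext_edges_subset[of u v xs e] 2(2) x by auto
      then show "g e * rigidity_matrix p e (x, i) = 0" by (simp add: rigidity_matrix_notin)
    qed
    then have "g {x, y} * (p x $ i - p y $ i) + g {x, z} * (p x $ i - p z $ i) = 0" for i
      using *[of "(x, i)"] new by (simp add: rigidity_matrix_doubleton)
    from this[of 1] this[of 2]
    have xy: "g {x, y} * (t x - t y) + g {x, z} * (t x - t z) = 0"
      "g {x, y} * ((t x)\<^sup>2 - (t y)\<^sup>2) + g {x, z} * ((t x)\<^sup>2 - (t z)\<^sup>2) = 0"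
      by (simp_all add: p)
    \<comment> \<open>Once the first coefficient is 0, the first coordinate gives the second because
      \<open>t x\<close> and \<open>t z\<close> differ.\<close>
    then have g: "g {x, y} = 0" "g {x, z} = 0"
      using parabola_not_collinear[of "t x" "t y" "t z" "g {x, y}" "g {x, z}"] t by auto
    then have "\<forall>e\<in>?F. g e = 0" using * IH unfolding independent_rows_def by simp
    then show "\<forall>e\<in>ext_edges u v ((x, y, z) # xs). g e = 0" using g by simp
  qed
qed

text \<open>The number of edges equals the required rank: independent rows in one realisation give
  rigidity, and after a deletion too few rows are left in every realisation.\<close>

lemma minimally_rigid_ext:
  assumes ok: "ext_ok u v xs"
  shows "minimally_rigid TYPE(2) (ext_verts u v xs, ext_edges u v xs)"
proof -
  let ?V = "ext_verts u v xs" and ?F = "ext_edges u v xs"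
  obtain f :: "'a \<Rightarrow> nat" where f: "inj_on f ?V"
    using finite_imp_inj_to_nat_seg[OF finite_ext_verts[of u v xs]] by metis
  define p :: "'a \<Rightarrow> real^2" where "p x = vector [real (f x), (real (f x))\<^sup>2]" for x
  have "inj_on (\<lambda>x. real (f x)) ?V" using f by (simp add: inj_on_def)
  then have "independent_rows ?F (rigidity_matrix p)"
    using independent_rows_ext[OF ok, of "\<lambda>x. real (f x)" p] by (simp add: p_def)
  then have rank: "matrix_rank ?F (rigidity_matrix p) = card ?F"
    by (rule matrix_rank_independent_rows[OF finite_ext_edges])
  have 3: "3 choose 2 = (3::nat)" by (simp add: numeral_eq_Suc)
  have "inf_rigid (?V, ?F) p"
    using rank card_ext_verts[OF ok] card_ext_edges[OF ok]
    by (simp add: inf_rigid_def 3)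
  moreover have "\<not> rigid TYPE(2) (?V, ?F - {e})" if "e \<in> ?F" for e
  proof
    assume "rigid TYPE(2) (?V, ?F - {e})"
    then obtain q :: "'a \<Rightarrow> real^2" where "inf_rigid (?V, ?F - {e}) q"
      unfolding rigid_def by blast
    then have "matrix_rank (?F - {e}) (rigidity_matrix q) = card ?F"
      using card_ext_verts[OF ok] card_ext_edges[OF ok]
      by (simp add: inf_rigid_def 3)
    moreover have "matrix_rank (?F - {e}) (rigidity_matrix q) \<le> card (?F - {e})"
      by (intro matrix_rank_le_card finite_Diff finite_ext_edges)
    moreover have "card (?F - {e}) < card ?F"
      using finite_ext_edges that by (rule card_Diff1_less)
    ultimately show False by simp
  qed
  ultimately show ?thesis unfolding minimally_rigid_def rigid_def by auto
qed

lemma minimally_rigidI: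
  assumes "ext_ok u v xs" "W = ext_verts u v xs" "F = ext_edges u v xs"
  shows "minimally_rigid TYPE(2) (W, F)"
  using minimally_rigid_ext assms by simp

text \<open>Parallel edges are excluded by counting: the image already has as many edges as \<open>F - {e}\<close>.\<close>

lemma contraction_minimally_rigidI:
  assumes "ext_ok u v xs" "contract_vertex e ` W = ext_verts u v xs"
    and "(\<lambda>f. contract_vertex e ` f) ` (F - {e}) = ext_edges u v xs"
    and "finite F" "card (F - {e}) = 2 * length xs + 1"
  shows "contraction_minimally_rigid TYPE(2) (W, F) e"
proof -
  have "inj_on (\<lambda>f. contract_vertex e ` f) (F - {e})"
    using assms by (intro eq_card_imp_inj_on) (auto simp: card_ext_edges)
  then show ?thesis
    using assms minimally_rigid_ext[OF assms(1)]
    by (simp add: contraction_minimally_rigid_def contract_def)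
qed

subsection \<open>Stresses\<close>

text \<open>The relation is indexed by vertices, so coinciding vectors are allowed: they give
  coefficients 1 and -1. Otherwise the image has more elements than the dimension.\<close>

lemma ex_linear_relation:
  fixes f :: "'v \<Rightarrow> 'a::euclidean_space"
  assumes "finite S" "DIM('a) < card S"
  obtains \<mu> where "\<exists>x. \<mu> x \<noteq> 0" "\<And>x. x \<notin> S \<Longrightarrow> \<mu> x = 0" "(\<Sum>x\<in>S. \<mu> x *\<^sub>R f x) = 0"
proof (cases "inj_on f S")
  case True
  then have "dependent (f ` S)"
    using assms by (intro dependent_biggerset) (simp_all add: card_image)
  then obtain u where u: "\<exists>v\<in>f ` S. u v \<noteq> 0" "(\<Sum>v\<in>f ` S. u v *\<^sub>R v) = 0"
    using dependent_finite[of "f ` S"] assms(1) by auto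
  show ?thesis
  proof (rule that[of "\<lambda>x. if x \<in> S then u (f x) else 0"])
    show "(\<Sum>x\<in>S. (if x \<in> S then u (f x) else 0) *\<^sub>R f x) = 0"
      using u(2) by (simp add: sum.reindex[OF True])
  qed (use u(1) in auto)
next
  case False
  then obtain x y where xy: "x \<in> S" "y \<in> S" "f x = f y" "x \<noteq> y"
    by (auto simp: inj_on_def)
  let ?\<mu> = "\<lambda>z. if z = x then 1 else if z = y then -1 else 0 :: real"
  show ?thesis
  proof (rule that[of ?\<mu>])
    have "(\<Sum>z\<in>S. ?\<mu> z *\<^sub>R f z) = (\<Sum>z\<in>{x, y}. ?\<mu> z *\<^sub>R f z)"
      using assms(1) xy by (intro sum.mono_neutral_right) auto
    then show "(\<Sum>z\<in>S. ?\<mu> z *\<^sub>R f z) = 0" using xy by simp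
  qed (use xy in auto)
qed

text \<open>Appending the coordinate 1 turns a linear relation into an affine one at the cost of one
  dimension.\<close>

lemma ex_affine_relation:
  fixes p :: "'v \<Rightarrow> 'a::euclidean_space"
  assumes "finite S" "DIM('a) + 1 < card S"
  obtains \<mu> where "\<exists>x. \<mu> x \<noteq> 0" "\<And>x. x \<notin> S \<Longrightarrow> \<mu> x = 0"
    "(\<Sum>x\<in>S. \<mu> x) = 0" "(\<Sum>x\<in>S. \<mu> x *\<^sub>R p x) = 0"
proof (rule ex_linear_relation[OF assms(1), of "\<lambda>x. (p x, 1 :: real)"])
  show "DIM('a \<times> real) < card S" using assms(2) by simp
next
  fix \<mu> assume *: "\<exists>x. \<mu> x \<noteq> 0" "\<And>x. x \<notin> S \<Longrightarrow> \<mu> x = 0"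
    "(\<Sum>x\<in>S. \<mu> x *\<^sub>R (p x, 1 :: real)) = 0"
  have "(\<Sum>x\<in>S. \<mu> x) = 0" "(\<Sum>x\<in>S. \<mu> x *\<^sub>R p x) = 0"
    using arg_cong[OF *(3), of snd] arg_cong[OF *(3), of fst] by (simp_all add: snd_sum fst_sum)
  with * show thesis by (intro that)
qed

text \<open>Edges at \<open>v\<close> correspond to neighbours of \<open>v\<close>. The sum extends
  to all of \<open>V\<close> since \<open>g\<close> vanishes on non-edges and the term
  \<open>w = v\<close> is 0.\<close>

lemma sum_rigidity_matrix:
  assumes G: "simple_graph (V, E)" and v: "v \<in> V"
    and nonedge: "\<And>w. w \<in> V \<Longrightarrow> w \<noteq> v \<Longrightarrow> {v, w} \<notin> E \<Longrightarrow> g {v, w} = 0"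
  shows "(\<Sum>e\<in>E. g e * rigidity_matrix p e (v, i)) = (\<Sum>w\<in>V. g {v, w} * (p v $ i - p w $ i))"
proof -
  have V: "finite V" and E: "\<And>e. e \<in> E \<Longrightarrow> e \<subseteq> V \<and> card e = 2"
    using G by (auto simp: simple_graph_def)
  have "E \<subseteq> Pow V" using E by blast
  then have finE: "finite E" using V by (meson finite_Pow_iff finite_subset)
  let ?N = "{w \<in> V. w \<noteq> v \<and> {v, w} \<in> E}"
  have edges: "(\<lambda>w. {v, w}) ` ?N = {e \<in> E. v \<in> e}"
  proof (intro equalityI subsetI)
    fix e assume e: "e \<in> {e \<in> E. v \<in> e}"
    then obtain x y where "e = {x, y}" "x \<noteq> y" using E[of e] by (auto simp: card_2_iff)
    then obtain w where "e = {v, w}" "v \<noteq> w" using e by auto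
    then show "e \<in> (\<lambda>w. {v, w}) ` ?N" using e E[of e] by auto
  qed auto
  have inj: "inj_on (\<lambda>w. {v, w}) ?N" by (auto simp: inj_on_def doubleton_eq_iff)
  have "(\<Sum>e\<in>E. g e * rigidity_matrix p e (v, i))
      = (\<Sum>e\<in>{e \<in> E. v \<in> e}. g e * rigidity_matrix p e (v, i))"
    using finE by (intro sum.mono_neutral_right) (auto simp: rigidity_matrix_notin)
  also have "\<dots> = (\<Sum>w\<in>?N. g {v, w} * rigidity_matrix p {v, w} (v, i))"
    unfolding edges[symmetric] by (simp add: sum.reindex[OF inj])
  also have "\<dots> = (\<Sum>w\<in>?N. g {v, w} * (p v $ i - p w $ i))"
    by (intro sum.cong) (auto simp: rigidity_matrix_doubleton)
  also have "\<dots> = (\<Sum>w\<in>V. g {v, w} * (p v $ i - p w $ i))"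
    using V nonedge by (intro sum.mono_neutral_left) auto
  finally show ?thesis .
qed

text \<open>Equilibrium at all vertices is a relation among the rows, as columns outside
  \<open>V\<close> are zero.\<close>

lemma stress_eq_0:
  assumes G: "simple_graph (V, E)" and ind: "independent_rows E (rigidity_matrix p)"
    and nonedge: "\<And>v w. v \<in> V \<Longrightarrow> w \<in> V \<Longrightarrow> v \<noteq> w \<Longrightarrow> {v, w} \<notin> E \<Longrightarrow> g {v, w} = 0"
    and eq: "\<And>v i. v \<in> V \<Longrightarrow> (\<Sum>w\<in>V. g {v, w} * (p v $ i - p w $ i)) = 0"
    and e: "e \<in> E"
  shows "g e = 0"
proof -
  have "(\<Sum>e\<in>E. g e * rigidity_matrix p e (v, i)) = 0" for v i
  proof (cases "v \<in> V")
    case True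
    then have "(\<Sum>e\<in>E. g e * rigidity_matrix p e (v, i))
        = (\<Sum>w\<in>V. g {v, w} * (p v $ i - p w $ i))"
      using nonedge by (intro sum_rigidity_matrix[OF G]) auto
    then show ?thesis using eq[OF True] by simp
  next
    case False
    then have "v \<notin> e" if "e \<in> E" for e using G that by (auto simp: simple_graph_def)
    then show ?thesis by (intro sum.neutral) (auto simp: rigidity_matrix_notin)
  qed
  then show ?thesis using ind[unfolded independent_rows_def, rule_format, of g e] e by auto
qed

text \<open>An affine relation \<open>\<mu>\<close> of the points of a complete graph gives the stress
  \<open>uv \<mapsto> \<mu> u * \<mu> v\<close>.\<close>

lemma affine_relation_equilibrium:
  fixes p :: "'v \<Rightarrow> real^'d"
  assumes "finite V" "S \<subseteq> V" "\<And>x. x \<notin> S \<Longrightarrow> \<mu> x = 0"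
    and "(\<Sum>x\<in>S. \<mu> x) = 0" "(\<Sum>x\<in>S. \<mu> x *\<^sub>R p x) = 0"
  shows "(\<Sum>w\<in>V. (\<Prod>x\<in>{v, w}. \<mu> x) * (p v $ i - p w $ i)) = 0"
proof -
  have "(\<Sum>w\<in>V. (\<Prod>x\<in>{v, w}. \<mu> x) * (p v $ i - p w $ i))
      = (\<Sum>w\<in>V. \<mu> v * (\<mu> w * (p v $ i - p w $ i)))"
  \<comment> \<open>For \<open>w = v\<close> the product has one factor only, but then the
    difference of coordinates is 0.\<close>
  proof (rule sum.cong)
    show "(\<Prod>x\<in>{v, w}. \<mu> x) * (p v $ i - p w $ i) = \<mu> v * (\<mu> w * (p v $ i - p w $ i))" for w
      by (cases "w = v") auto
  qed simp
  also have "\<dots> = (\<Sum>w\<in>S. \<mu> v * (\<mu> w * (p v $ i - p w $ i)))"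
    using assms(1-3) by (intro sum.mono_neutral_right) auto
  also have "\<dots> = \<mu> v * ((\<Sum>w\<in>S. \<mu> w) * p v $ i - (\<Sum>w\<in>S. \<mu> w *\<^sub>R p w) $ i)"
    by (simp add: sum_distrib_left sum_distrib_right sum_subtractf algebra_simps)
  finally show ?thesis using assms(4,5) by simp
qed

text \<open>A single nonzero term cannot sum to 0. The pair found carries a nonzero value of the
  stress built from \<open>\<mu>\<close>.\<close>

lemma affine_relation_two_nonzero:
  fixes \<mu> :: "'v \<Rightarrow> real"
  assumes "finite S" "\<exists>x. \<mu> x \<noteq> 0" "\<And>x. x \<notin> S \<Longrightarrow> \<mu> x = 0" "(\<Sum>x\<in>S. \<mu> x) = 0"
  obtains x y where "x \<in> S" "y \<in> S" "x \<noteq> y" "\<mu> x * \<mu> y \<noteq> 0"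
proof -
  obtain x where x: "x \<in> S" "\<mu> x \<noteq> 0" using assms(2,3) by blast
  have "\<mu> x + (\<Sum>y\<in>S - {x}. \<mu> y) = 0"
    using sum.remove[OF assms(1) x(1), of \<mu>] assms(4) by simp
  then have "(\<Sum>y\<in>S - {x}. \<mu> y) \<noteq> 0" using x(2) by auto
  then obtain y where "y \<in> S - {x}" "\<mu> y \<noteq> 0" by (meson sum.neutral)
  then show thesis using x that[of x y] by auto
qed

subsection \<open>The double banana\<close>

text \<open>Separate vertex arguments allow symmetries to be expressed by permuting them.\<close>

definition bananas :: "'v \<Rightarrow> 'v \<Rightarrow> 'v \<Rightarrow> 'v \<Rightarrow> 'v \<Rightarrow> 'v \<Rightarrow> 'v \<Rightarrow> 'v \<Rightarrow> 'v graph" where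
  "bananas r1 r2 a1 b1 c1 a2 b2 c2 =
    ({r1, r2, a1, b1, c1, a2, b2, c2},
     {{r1, a1}, {r1, b1}, {r1, c1}, {r2, a1}, {r2, b1}, {r2, c1}, {a1, b1}, {a1, c1}, {b1, c1},
      {r1, a2}, {r1, b2}, {r1, c2}, {r2, a2}, {r2, b2}, {r2, c2}, {a2, b2}, {a2, c2}, {b2, c2}})"

lemma double_banana_eq_bananas:
  "double_banana r a b c = bananas (r 1) (r 2) (a 1) (b 1) (c 1) (a 2) (b 2) (c 2)"
  by (simp add: double_banana_def bananas_def insert_commute)

section \<open>Partitions for the two types of edges\<close>

text \<open>If \<open>w\<close> is adjacent to both ends of \<open>e\<close>, contraction makes its
  two edges to \<open>e\<close> parallel. As both contractions use \<open>S3\<close>, one of these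
  edges must lie in \<open>S1\<close> and the other in \<open>S2\<close>; here \<open>w\<close> is
  \<open>b1\<close> or \<open>c1\<close>.\<close>

lemma good_partition_spoke:
  assumes d: "distinct [r1, r2, a1, b1, c1, a2, b2, c2]"
  shows "\<exists>S1 S2 S3. good_partition (bananas r1 r2 a1 b1 c1 a2 b2 c2) {r1, a1} S1 S2 S3"
proof -
  \<comment> \<open>The reversed list supplies each inequality in the other orientation for the
    simplifier.\<close>
  have "distinct [c2, b2, a2, c1, b1, a1, r2, r1]" using d by auto
  note neq = d[simplified] this[simplified]
  let ?V = "{r1, r2, a1, b1, c1, a2, b2, c2}"
  let ?e = "{r1, a1}"
  let ?S1 = "{{r1, a1}, {r2, c1}, {r2, a2}, {r2, c2}, {a1, b1}, {a1, c1}, {b2, c2}}"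
  let ?S2 = "{{r1, b1}, {r1, c1}, {r1, a2}, {r1, c2}, {r2, b1}, {a2, b2}}"
  let ?S3 = "{{r1, b2}, {r2, a1}, {r2, b2}, {b1, c1}, {a2, c2}}"
  have "minimally_rigid TYPE(2) (?V, ?S1 \<union> ?S2)"
  proof (rule minimally_rigidI)
    show "ext_ok c1 r1
      [(b2, a2, c2), (a2, r1, r2), (c2, r1, r2), (r2, b1, c1), (b1, a1, r1), (a1, c1, r1)]"
      (is "ext_ok _ _ ?xs")
      by (simp add: neq)
    show "?V = ext_verts c1 r1 ?xs" by (simp add: insert_commute)
    show "?S1 \<union> ?S2 = ext_edges c1 r1 ?xs" by (simp add: insert_commute)
  qed
  moreover have "contraction_minimally_rigid TYPE(2) (?V, ?S1 \<union> ?S3) ?e"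
  proof (rule contraction_minimally_rigidI)
    \<comment> \<open>Vertices of the contraction are classes: \<open>{r1, a1}\<close> is the merged
      vertex, the others are singletons.\<close>
    show "ext_ok {c2} {r2}
      [({a2}, {c2}, {r2}), ({b1}, {r1, a1}, {c1}), ({c1}, {r1, a1}, {r2}),
       ({r1, a1}, {b2}, {r2}), ({b2}, {c2}, {r2})]"
      (is "ext_ok _ _ ?xs")
      by (simp add: neq doubleton_eq_iff)
    show "contract_vertex ?e ` ?V = ext_verts {c2} {r2} ?xs"
      by (simp add: neq insert_commute contract_vertex_def)
    show "(\<lambda>f. contract_vertex ?e ` f) ` ((?S1 \<union> ?S3) - {?e}) = ext_edges {c2} {r2} ?xs"
      by (simp add: neq contract_vertex_def insert_Diff_if doubleton_eq_iff insert_commute)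
    show "finite (?S1 \<union> ?S3)" by simp
    show "card ((?S1 \<union> ?S3) - {?e}) = 2 * length ?xs + 1"
      by (simp add: neq insert_Diff_if doubleton_eq_iff)
  qed
  \<comment> \<open>Here \<open>?e\<close> is added only to be contracted; the 6 + 5 = 2 * 7 - 3
    edges of \<open>?S2\<close> and \<open>?S3\<close> remain.\<close>
  moreover have "contraction_minimally_rigid TYPE(2) (?V, ?S2 \<union> ?S3 \<union> {?e}) ?e"
  proof (rule contraction_minimally_rigidI)
    show "ext_ok {b2} {r2}
      [({c1}, {r1, a1}, {b1}), ({b1}, {r1, a1}, {r2}), ({c2}, {r1, a1}, {a2}),
       ({a2}, {r1, a1}, {b2}), ({r1, a1}, {b2}, {r2})]"
      (is "ext_ok _ _ ?xs")
      by (simp add: neq doubleton_eq_iff)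
    show "contract_vertex ?e ` ?V = ext_verts {b2} {r2} ?xs"
      by (simp add: neq insert_commute contract_vertex_def)
    show "(\<lambda>f. contract_vertex ?e ` f) ` ((?S2 \<union> ?S3 \<union> {?e}) - {?e}) = ext_edges {b2} {r2} ?xs"
      by (simp add: neq contract_vertex_def insert_Diff_if doubleton_eq_iff insert_commute)
    show "finite (?S2 \<union> ?S3 \<union> {?e})" by simp
    show "card ((?S2 \<union> ?S3 \<union> {?e}) - {?e}) = 2 * length ?xs + 1"
      by (simp add: neq insert_Diff_if doubleton_eq_iff)
  qed
  moreover have "?S1 \<union> ?S2 \<union> ?S3 = snd (bananas r1 r2 a1 b1 c1 a2 b2 c2)"
    by (simp add: bananas_def insert_commute)
  moreover have "card ?V = 8" "card ?S1 = 7" "card ?S2 = 6" "card ?S3 = 5"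
    by (simp_all add: neq doubleton_eq_iff)
  moreover have "?S1 \<inter> ?S2 = {}" "?S1 \<inter> ?S3 = {}" "?S2 \<inter> ?S3 = {}"
    by (simp_all add: neq doubleton_eq_iff)
  ultimately have "good_partition (bananas r1 r2 a1 b1 c1 a2 b2 c2) ?e ?S1 ?S2 ?S3"
    by (simp add: good_partition_def bananas_def)
  then show ?thesis by blast
qed

text \<open>The common neighbours of the ends of \<open>e\<close> are now \<open>r1\<close>,
  \<open>r2\<close> and \<open>c1\<close>; each sends one edge to \<open>e\<close> in
  \<open>S1\<close> and one in \<open>S2\<close>.\<close>

lemma good_partition_rim:
  assumes d: "distinct [r1, r2, a1, b1, c1, a2, b2, c2]"
  shows "\<exists>S1 S2 S3. good_partition (bananas r1 r2 a1 b1 c1 a2 b2 c2) {a1, b1} S1 S2 S3"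
proof -
  have "distinct [c2, b2, a2, c1, b1, a1, r2, r1]" using d by auto
  note neq = d[simplified] this[simplified]
  let ?V = "{r1, r2, a1, b1, c1, a2, b2, c2}"
  let ?e = "{a1, b1}"
  let ?S1 = "{{a1, b1}, {r1, a1}, {r1, a2}, {r1, b2}, {r2, a1}, {b1, c1}, {a2, c2}}"
  let ?S2 = "{{r1, b1}, {r2, b1}, {r2, b2}, {r2, c2}, {a1, c1}, {a2, b2}}"
  let ?S3 = "{{r1, c1}, {r1, c2}, {r2, c1}, {r2, a2}, {b2, c2}}"
  have "minimally_rigid TYPE(2) (?V, ?S1 \<union> ?S2)"
  proof (rule minimally_rigidI)
    show "ext_ok b1 r2
      [(c1, a1, b1), (c2, a2, r2), (a2, b2, r1), (b2, r1, r2), (r1, a1, b1), (a1, b1, r2)]"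
      (is "ext_ok _ _ ?xs")
      by (simp add: neq)
    show "?V = ext_verts b1 r2 ?xs" by (simp add: insert_commute)
    show "?S1 \<union> ?S2 = ext_edges b1 r2 ?xs" by (simp add: insert_commute)
  qed
  moreover have "contraction_minimally_rigid TYPE(2) (?V, ?S1 \<union> ?S3) ?e"
  proof (rule contraction_minimally_rigidI)
    show "ext_ok {c1} {r2}
      [({b2}, {c2}, {r1}), ({c2}, {a2}, {r1}), ({a2}, {r1}, {r2}), ({r1}, {a1, b1}, {c1}),
       ({a1, b1}, {c1}, {r2})]"
      (is "ext_ok _ _ ?xs")
      by (simp add: neq doubleton_eq_iff)
    show "contract_vertex ?e ` ?V = ext_verts {c1} {r2} ?xs"
      by (simp add: neq insert_commute contract_vertex_def)
    show "(\<lambda>f. contract_vertex ?e ` f) ` ((?S1 \<union> ?S3) - {?e}) = ext_edges {c1} {r2} ?xs"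
      by (simp add: neq contract_vertex_def insert_Diff_if doubleton_eq_iff insert_commute)
    show "finite (?S1 \<union> ?S3)" by simp
    show "card ((?S1 \<union> ?S3) - {?e}) = 2 * length ?xs + 1"
      by (simp add: neq insert_Diff_if doubleton_eq_iff)
  qed
  moreover have "contraction_minimally_rigid TYPE(2) (?V, ?S2 \<union> ?S3 \<union> {?e}) ?e"
  proof (rule contraction_minimally_rigidI)
    \<comment> \<open>The first banana is built as in the previous contraction; only the attachment
      of \<open>a2\<close>, \<open>b2\<close>, \<open>c2\<close> differs.\<close>
    show "ext_ok {c1} {r2}
      [({a2}, {b2}, {r2}), ({b2}, {c2}, {r2}), ({c2}, {r1}, {r2}), ({r1}, {a1, b1}, {c1}),
       ({a1, b1}, {c1}, {r2})]"
      (is "ext_ok _ _ ?xs")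
      by (simp add: neq doubleton_eq_iff)
    show "contract_vertex ?e ` ?V = ext_verts {c1} {r2} ?xs"
      by (simp add: neq insert_commute contract_vertex_def)
    show "(\<lambda>f. contract_vertex ?e ` f) ` ((?S2 \<union> ?S3 \<union> {?e}) - {?e}) = ext_edges {c1} {r2} ?xs"
      by (simp add: neq contract_vertex_def insert_Diff_if doubleton_eq_iff insert_commute)
    show "finite (?S2 \<union> ?S3 \<union> {?e})" by simp
    show "card ((?S2 \<union> ?S3 \<union> {?e}) - {?e}) = 2 * length ?xs + 1"
      by (simp add: neq insert_Diff_if doubleton_eq_iff)
  qed
  moreover have "?S1 \<union> ?S2 \<union> ?S3 = snd (bananas r1 r2 a1 b1 c1 a2 b2 c2)"
    by (simp add: bananas_def insert_commute)
  moreover have "card ?V = 8" "card ?S1 = 7" "card ?S2 = 6" "card ?S3 = 5"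
    by (simp_all add: neq doubleton_eq_iff)
  moreover have "?S1 \<inter> ?S2 = {}" "?S1 \<inter> ?S3 = {}" "?S2 \<inter> ?S3 = {}"
    by (simp_all add: neq doubleton_eq_iff)
  ultimately have "good_partition (bananas r1 r2 a1 b1 c1 a2 b2 c2) ?e ?S1 ?S2 ?S3"
    by (simp add: good_partition_def bananas_def)
  then show ?thesis by blast
qed

section \<open>Edge count and failure of 3-rigidity\<close>

lemma simple_graph_bananas:
  assumes d: "distinct [r1, r2, a1, b1, c1, a2, b2, c2]"
  shows "simple_graph (bananas r1 r2 a1 b1 c1 a2 b2 c2)"
    "card (fst (bananas r1 r2 a1 b1 c1 a2 b2 c2)) = 8"
    "card (snd (bananas r1 r2 a1 b1 c1 a2 b2 c2)) = 18"
proof -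
  have "distinct [c2, b2, a2, c1, b1, a1, r2, r1]" using d by auto
  note neq = d[simplified] this[simplified]
  show "simple_graph (bananas r1 r2 a1 b1 c1 a2 b2 c2)"
    "card (fst (bananas r1 r2 a1 b1 c1 a2 b2 c2)) = 8"
    "card (snd (bananas r1 r2 a1 b1 c1 a2 b2 c2)) = 18"
    by (simp_all add: neq bananas_def simple_graph_def doubleton_eq_iff)
qed

text \<open>Each banana together with the missing edge \<open>r1r2\<close> is a \<open>K\<^sub>5\<close> and hence has a stress.
  A combination of the two stresses that vanishes on \<open>r1r2\<close> is a stress of the double banana;
  it is nonzero unless \<open>p r1 = p r2\<close>. In that case an arbitrary linear relation \<open>\<mu>\<close> of the
  vectors \<open>p x - p r1\<close> gives a stress with value \<open>\<mu> x\<close> on \<open>r1x\<close> and \<open>- \<mu> x\<close> on \<open>r2x\<close>.\<close>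

lemma not_rigid_bananas:
  assumes d: "distinct [r1, r2, a1, b1, c1, a2, b2, c2]"
  shows "\<not> rigid TYPE(3) (bananas r1 r2 a1 b1 c1 a2 b2 c2)"
proof
  have "distinct [c2, b2, a2, c1, b1, a1, r2, r1]" using d by auto
  note neq = d[simplified] this[simplified]
  let ?S1 = "{r1, r2, a1, b1, c1}" and ?S2 = "{r1, r2, a2, b2, c2}"
  obtain V E where VE: "bananas r1 r2 a1 b1 c1 a2 b2 c2 = (V, E)"
    by (cases "bananas r1 r2 a1 b1 c1 a2 b2 c2")
  have V: "V = {r1, r2, a1, b1, c1, a2, b2, c2}"
    and E: "E = {{r1, a1}, {r1, b1}, {r1, c1}, {r2, a1}, {r2, b1}, {r2, c1},
       {a1, b1}, {a1, c1}, {b1, c1}, {r1, a2}, {r1, b2}, {r1, c2}, {r2, a2}, {r2, b2}, {r2, c2},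
       {a2, b2}, {a2, c2}, {b2, c2}}"
    using VE by (simp_all add: bananas_def)
  have G: "simple_graph (V, E)" "card V = 8" "card E = 18"
    using simple_graph_bananas[OF d] by (simp_all add: VE)
  \<comment> \<open>Each banana is a complete graph on five vertices without
    \<open>{r1, r2}\<close>.\<close>
  have edge: "{v, w} \<in> E"
    if "v \<in> ?S1 \<and> w \<in> ?S1 \<or> v \<in> ?S2 \<and> w \<in> ?S2" "v \<noteq> w" "{v, w} \<noteq> {r1, r2}" for v w
    using that unfolding E by (elim disjE conjE insertE emptyE) (simp_all add: insert_commute)
  assume "rigid TYPE(3) (bananas r1 r2 a1 b1 c1 a2 b2 c2)"
  then obtain p :: "'a \<Rightarrow> real^3" where "inf_rigid (V, E) p"
    unfolding VE rigid_def by blast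
  \<comment> \<open>Since 3 * 8 - 6 = 18, rigidity means full row rank.\<close>
  moreover have "(4 :: nat) choose 2 = 6" by (simp add: numeral_eq_Suc)
  ultimately have "matrix_rank E (rigidity_matrix p) = card E"
    using G by (simp add: inf_rigid_def)
  then have "independent_rows E (rigidity_matrix p)"
    using G(3) by (intro independent_rows_if_matrix_rank card_ge_0_finite) simp
  note no_stress = stress_eq_0[OF G(1) this]
  show False
  proof (cases "p r1 = p r2")
    case True
    \<comment> \<open>Four common neighbours of \<open>r1\<close> and \<open>r2\<close>, one more
      than the dimension; a single banana has only three.\<close>
    let ?S = "{a1, b1, c1, a2}"
    have "DIM(real^3) < card ?S" by (simp add: neq)
    then obtain \<mu> where \<mu>: "\<exists>x. \<mu> x \<noteq> 0" "\<And>x. x \<notin> ?S \<Longrightarrow> \<mu> x = 0"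
      and rel: "(\<Sum>x\<in>?S. \<mu> x *\<^sub>R (p x - p r1)) = 0"
      using ex_linear_relation[of ?S "\<lambda>x. p x - p r1"] by auto
    define \<sigma> where "\<sigma> x = (if x = r1 then 1 else if x = r2 then -1 else 0 :: real)" for x
    \<comment> \<open>A function of the unordered pair; as \<open>\<sigma>\<close> and
      \<open>\<mu>\<close> have disjoint supports, it is the symmetrised product of the two.\<close>
    define g where "g e = (\<Sum>x\<in>e. \<sigma> x) * (\<Sum>x\<in>e. \<mu> x)" for e
    have \<sigma>\<mu>: "\<mu> x * \<sigma> x = 0" for x using \<mu>(2)[of x] neq by (auto simp: \<sigma>_def)
    have g_eq: "g {v, w} = \<sigma> v * \<mu> w + \<sigma> w * \<mu> v" if "v \<noteq> w" for v w
      using \<sigma>\<mu>[of v] \<sigma>\<mu>[of w] that by (auto simp: g_def distrib_left distrib_right mult.commute)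
    have g: "g {v, w} * (p v $ i - p w $ i)
        = (\<sigma> v * \<mu> w + \<sigma> w * \<mu> v) * (p v $ i - p w $ i)" for v w i
      by (cases "v = w") (simp_all add: g_eq)
    obtain x where x: "\<mu> x \<noteq> 0" using \<mu>(1) by (rule exE)
    have xS: "x \<in> ?S" using x by (rule contrapos_np) (rule \<mu>(2))
    have "g {r1, x} = 0"
    proof (rule no_stress[where g = g])
      show "{r1, x} \<in> E" using xS unfolding E by (elim insertE emptyE) simp_all
      show "(\<Sum>w\<in>V. g {v, w} * (p v $ i - p w $ i)) = 0" for v i
      proof -
        have "(\<Sum>w\<in>V. \<mu> w * (p r1 $ i - p w $ i)) = (\<Sum>w\<in>?S. \<mu> w * (p r1 $ i - p w $ i))"
          using \<mu>(2) unfolding V by (intro sum.mono_neutral_right) auto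
        also have "\<dots> = - (\<Sum>w\<in>?S. \<mu> w *\<^sub>R (p w - p r1)) $ i"
          by (simp add: algebra_simps sum_subtractf flip: sum_negf)
        also have "\<dots> = 0" unfolding rel by simp
        finally have "(\<Sum>w\<in>V. \<mu> w * (p r1 $ i - p w $ i)) = 0" .
        \<comment> \<open>\<open>\<sigma>\<close> is supported on \<open>r1\<close> and
          \<open>r2\<close>, which share the position \<open>p r1\<close>.\<close>
        then have "\<sigma> v * (\<Sum>w\<in>V. \<mu> w * (p v $ i - p w $ i)) = 0"
          using True by (simp add: \<sigma>_def)
        moreover have "(\<Sum>w\<in>V. \<sigma> w * (p v $ i - p w $ i)) = 0"
          using True neq by (simp add: V \<sigma>_def)
        moreover have "(\<Sum>w\<in>V. g {v, w} * (p v $ i - p w $ i))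
            = \<sigma> v * (\<Sum>w\<in>V. \<mu> w * (p v $ i - p w $ i))
              + \<mu> v * (\<Sum>w\<in>V. \<sigma> w * (p v $ i - p w $ i))"
          unfolding g sum_distrib_left sum.distrib[symmetric]
          by (intro sum.cong) (simp_all add: algebra_simps)
        ultimately show ?thesis by simp
      qed
      show "g {v, w} = 0" if "v \<in> V" "w \<in> V" "v \<noteq> w" "{v, w} \<notin> E" for v w
      proof -
        have "{v, w} \<in> E" if "\<sigma> v \<noteq> 0" "\<mu> w \<noteq> 0" for v w
        proof -
          have "w \<in> ?S" using that(2) by (rule contrapos_np) (rule \<mu>(2))
          moreover have "v = r1 \<or> v = r2" using that(1) by (simp add: \<sigma>_def split: if_splits)
          ultimately show ?thesis unfolding E by (elim disjE insertE emptyE) simp_all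
        qed
        from this[of v w] this[of w v] have "\<sigma> v * \<mu> w = 0" "\<sigma> w * \<mu> v = 0"
          using that(4) by (auto simp: insert_commute)
        then show ?thesis unfolding g_eq[OF that(3)] by (simp only: add_0)
      qed
    qed
    moreover have "g {r1, x} = \<mu> x"
    proof -
      have "x \<noteq> r1" "\<sigma> x = 0" using \<sigma>\<mu>[of x] \<mu>(2)[of r1] x neq by auto
      then show ?thesis using g_eq[of r1 x] by (simp add: \<sigma>_def)
    qed
    ultimately show False using x by simp
  next
    case False
    have fin: "finite ?S1" "finite ?S2" by simp_all
    have card: "DIM(real^3) + 1 < card ?S1" "DIM(real^3) + 1 < card ?S2" by (simp_all add: neq)
    obtain \<mu> where \<mu>: "\<exists>x. \<mu> x \<noteq> 0" "\<And>x. x \<notin> ?S1 \<Longrightarrow> \<mu> x = 0"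
        "(\<Sum>x\<in>?S1. \<mu> x) = 0" "(\<Sum>x\<in>?S1. \<mu> x *\<^sub>R p x) = 0"
      by (rule ex_affine_relation[OF fin(1) card(1), of p]) (rule that)
    obtain \<nu> where \<nu>: "\<exists>x. \<nu> x \<noteq> 0" "\<And>x. x \<notin> ?S2 \<Longrightarrow> \<nu> x = 0"
        "(\<Sum>x\<in>?S2. \<nu> x) = 0" "(\<Sum>x\<in>?S2. \<nu> x *\<^sub>R p x) = 0"
      by (rule ex_affine_relation[OF fin(2) card(2), of p]) (rule that)
    \<comment> \<open>The hypothesis on \<open>\<alpha>\<close> and \<open>\<beta>\<close> makes the
      combined stress vanish on the missing edge \<open>{r1, r2}\<close>.\<close>
    have stress: "\<alpha> * (\<Prod>x\<in>e. \<mu> x) = \<beta> * (\<Prod>x\<in>e. \<nu> x)"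
      if e: "e \<in> E" and "\<alpha> * (\<mu> r1 * \<mu> r2) = \<beta> * (\<nu> r1 * \<nu> r2)" for \<alpha> \<beta> e
    proof -
      define g where "g e = \<alpha> * (\<Prod>x\<in>e. \<mu> x) - \<beta> * (\<Prod>x\<in>e. \<nu> x)" for e
      have "g e = 0"
      proof (rule no_stress[where g = g, OF _ _ e])
        show "(\<Sum>w\<in>V. g {v, w} * (p v $ i - p w $ i)) = 0" for v i
        proof -
          have "(\<Sum>w\<in>V. g {v, w} * (p v $ i - p w $ i))
              = \<alpha> * (\<Sum>w\<in>V. (\<Prod>x\<in>{v, w}. \<mu> x) * (p v $ i - p w $ i))
                - \<beta> * (\<Sum>w\<in>V. (\<Prod>x\<in>{v, w}. \<nu> x) * (p v $ i - p w $ i))"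
            unfolding g_def sum_distrib_left sum_subtractf[symmetric]
            by (intro sum.cong) (auto simp: algebra_simps simp del: prod.insert)
          moreover have "(\<Sum>w\<in>V. (\<Prod>x\<in>{v, w}. \<mu> x) * (p v $ i - p w $ i)) = 0"
            by (rule affine_relation_equilibrium[where S = ?S1]) (use \<mu> V in auto)
          moreover have "(\<Sum>w\<in>V. (\<Prod>x\<in>{v, w}. \<nu> x) * (p v $ i - p w $ i)) = 0"
            by (rule affine_relation_equilibrium[where S = ?S2]) (use \<nu> V in auto)
          ultimately show ?thesis by simp
        qed
        show "g {v, w} = 0" if "v \<noteq> w" "{v, w} \<notin> E" for v w
        proof (cases "{v, w} = {r1, r2}")
          case True
          then show ?thesis
            using \<open>\<alpha> * (\<mu> r1 * \<mu> r2) = \<beta> * (\<nu> r1 * \<nu> r2)\<close> neq by (simp add: g_def)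
        next
          case False
          \<comment> \<open>Every other non-edge joins different bananas, so both products have a
            zero factor.\<close>
          have "\<not> (v \<in> ?S1 \<and> w \<in> ?S1 \<or> v \<in> ?S2 \<and> w \<in> ?S2)"
            using that(2) by (rule contrapos_nn) (rule edge[OF _ that(1) False])
          then have S: "v \<notin> ?S1 \<or> w \<notin> ?S1" "v \<notin> ?S2 \<or> w \<notin> ?S2"
            by (simp_all only: de_Morgan_disj de_Morgan_conj)
          have "\<mu> v * \<mu> w = 0" using S(1) by (metis \<mu>(2) mult_zero_left mult_zero_right)
          moreover have "\<nu> v * \<nu> w = 0" using S(2) by (metis \<nu>(2) mult_zero_left mult_zero_right)
          ultimately show ?thesis using that(1) by (auto simp: g_def)
        qed
      qed
      then show ?thesis by (simp add: g_def)
    qed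
    \<comment> \<open>Otherwise the stress of the first banana alone would be a nonzero stress of
      the whole graph.\<close>
    have \<mu>r: "\<mu> r1 * \<mu> r2 \<noteq> 0"
    proof
      assume 0: "\<mu> r1 * \<mu> r2 = 0"
      obtain x y where xy: "x \<in> ?S1" "y \<in> ?S1" "x \<noteq> y" "\<mu> x * \<mu> y \<noteq> 0"
        by (rule affine_relation_two_nonzero[OF fin(1) \<mu>(1-3)])
      have "{x, y} \<noteq> {r1, r2}" using 0 xy(4) by (auto simp: doubleton_eq_iff)
      with xy(1-3) have "{x, y} \<in> E" by (intro edge disjI1 conjI)
      then show False using stress[of "{x, y}" 1 0] xy(3,4) 0 by simp
    qed
    have \<nu>r: "\<nu> r1 * \<nu> r2 \<noteq> 0"
    proof
      assume 0: "\<nu> r1 * \<nu> r2 = 0"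
      obtain x y where xy: "x \<in> ?S2" "y \<in> ?S2" "x \<noteq> y" "\<nu> x * \<nu> y \<noteq> 0"
        by (rule affine_relation_two_nonzero[OF fin(2) \<nu>(1-3)])
      have "{x, y} \<noteq> {r1, r2}" using 0 xy(4) by (auto simp: doubleton_eq_iff)
      with xy(1-3) have "{x, y} \<in> E" by (intro edge disjI2 conjI)
      then show False using stress[of "{x, y}" 0 1] xy(3,4) 0 by simp
    qed
    \<comment> \<open>Cross-multiplying the values on \<open>{r1, r2}\<close> balances the stresses;
      on \<open>{r1, x}\<close> the second one vanishes, so the first must too.\<close>
    have "\<mu> x = 0" if "x \<in> {a1, b1, c1}" for x
    proof -
      have "{r1, x} \<in> E" "r1 \<noteq> x" "x \<notin> ?S2"
        using that by (elim insertE emptyE; simp add: E neq)+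
      moreover from this(3) have "\<nu> x = 0" by (rule \<nu>(2))
      ultimately have "(\<nu> r1 * \<nu> r2) * (\<mu> r1 * \<mu> x) = 0"
        using stress[of "{r1, x}" "\<nu> r1 * \<nu> r2" "\<mu> r1 * \<mu> r2"] by simp
      then show ?thesis using \<mu>r \<nu>r by simp
    qed
    \<comment> \<open>The affine relation now involves only \<open>r1\<close> and \<open>r2\<close>,
      which forces their positions to coincide.\<close>
    then have "\<mu> r1 + \<mu> r2 = 0" "\<mu> r1 *\<^sub>R p r1 + \<mu> r2 *\<^sub>R p r2 = 0"
      using \<mu>(3,4) by (simp_all add: neq)
    then have "\<mu> r1 *\<^sub>R (p r1 - p r2) = 0"
      by (simp add: eq_neg_iff_add_eq_0[symmetric] algebra_simps)
    then show False using \<mu>r False by simp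
  qed
qed

section \<open>All edges by symmetry, and the counterexample\<close>

text \<open>Swapping \<open>r1\<close> with \<open>r2\<close>, swapping the bananas and rotating
  \<open>a\<close>, \<open>b\<close>, \<open>c\<close> carry \<open>{r1, a1}\<close> to all 12 edges
  at \<open>r1\<close> or \<open>r2\<close>, and \<open>{a1, b1}\<close> to the other 6.\<close>

lemma good_partition_bananas:
  assumes d: "distinct [r1, r2, a1, b1, c1, a2, b2, c2]"
    and e: "e \<in> snd (bananas r1 r2 a1 b1 c1 a2 b2 c2)"
  shows "\<exists>S1 S2 S3. good_partition (bananas r1 r2 a1 b1 c1 a2 b2 c2) e S1 S2 S3"
proof -
  have "distinct [c2, b2, a2, c1, b1, a1, r2, r1]" using d by auto
  note neq = d[simplified] this[simplified]
  let ?G = "bananas r1 r2 a1 b1 c1 a2 b2 c2"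
  let ?P = "\<lambda>e. \<exists>S1 S2 S3. good_partition ?G e S1 S2 S3"
  have sym: "bananas r2 r1 a1 b1 c1 a2 b2 c2 = ?G" "bananas r1 r2 b1 c1 a1 a2 b2 c2 = ?G"
    "bananas r1 r2 c1 a1 b1 a2 b2 c2 = ?G" "bananas r2 r1 b1 c1 a1 a2 b2 c2 = ?G"
    "bananas r2 r1 c1 a1 b1 a2 b2 c2 = ?G" "bananas r1 r2 a2 b2 c2 a1 b1 c1 = ?G"
    "bananas r2 r1 a2 b2 c2 a1 b1 c1 = ?G" "bananas r1 r2 b2 c2 a2 a1 b1 c1 = ?G"
    "bananas r1 r2 c2 a2 b2 a1 b1 c1 = ?G" "bananas r2 r1 b2 c2 a2 a1 b1 c1 = ?G"
    "bananas r2 r1 c2 a2 b2 a1 b1 c1 = ?G"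
    by (simp_all add: bananas_def insert_commute)
  have "?P {r1, a1}" "?P {r1, b1}" "?P {r1, c1}" "?P {r2, a1}" "?P {r2, b1}" "?P {r2, c1}"
    "?P {r1, a2}" "?P {r1, b2}" "?P {r1, c2}" "?P {r2, a2}" "?P {r2, b2}" "?P {r2, c2}"
    using good_partition_spoke[of r1 r2 a1 b1 c1 a2 b2 c2]
      good_partition_spoke[of r1 r2 b1 c1 a1 a2 b2 c2]
      good_partition_spoke[of r1 r2 c1 a1 b1 a2 b2 c2]
      good_partition_spoke[of r2 r1 a1 b1 c1 a2 b2 c2]
      good_partition_spoke[of r2 r1 b1 c1 a1 a2 b2 c2]
      good_partition_spoke[of r2 r1 c1 a1 b1 a2 b2 c2]
      good_partition_spoke[of r1 r2 a2 b2 c2 a1 b1 c1]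
      good_partition_spoke[of r1 r2 b2 c2 a2 a1 b1 c1]
      good_partition_spoke[of r1 r2 c2 a2 b2 a1 b1 c1]
      good_partition_spoke[of r2 r1 a2 b2 c2 a1 b1 c1]
      good_partition_spoke[of r2 r1 b2 c2 a2 a1 b1 c1]
      good_partition_spoke[of r2 r1 c2 a2 b2 a1 b1 c1]
    by (simp_all only: sym neq distinct.simps list.set insert_iff empty_iff simp_thms)
  moreover have "?P {a1, b1}" "?P {a1, c1}" "?P {b1, c1}" "?P {a2, b2}" "?P {a2, c2}" "?P {b2, c2}"
    using good_partition_rim[of r1 r2 a1 b1 c1 a2 b2 c2]
      good_partition_rim[of r1 r2 b1 c1 a1 a2 b2 c2]
      good_partition_rim[of r1 r2 c1 a1 b1 a2 b2 c2]
      good_partition_rim[of r1 r2 a2 b2 c2 a1 b1 c1]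
      good_partition_rim[of r1 r2 b2 c2 a2 a1 b1 c1]
      good_partition_rim[of r1 r2 c2 a2 b2 a1 b1 c1]
    by (simp_all only: sym neq distinct.simps list.set insert_iff empty_iff simp_thms insert_commute)
  ultimately show ?thesis
    using e unfolding bananas_def snd_conv by (elim insertE emptyE) (simp_all only:)
qed

theorem mainTheorem1:
  fixes r a b c :: "nat \<Rightarrow> 'v" and V :: "'v set" and E :: "'v set set"
  assumes "distinct [r 1, r 2, a 1, b 1, c 1, a 2, b 2, c 2]"
    and "(V, E) = double_banana r a b c"
  shows "simple_graph (V, E) \<and> card V = 8 \<and> card E = 18 \<and>
    (\<forall>e\<in>E. \<exists>S1 S2 S3. good_partition (V, E) e S1 S2 S3) \<and>
    \<not> rigid TYPE(3) (V, E) \<and>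
    \<not> (\<forall>(W :: 'v set) F. simple_graph (W, F) \<and> card W \<ge> 4 \<and>
         (\<forall>e\<in>F. \<exists>S1 S2 S3. good_partition (W, F) e S1 S2 S3) \<longrightarrow>
         minimally_rigid TYPE(3) (W, F))"
proof -
  let ?G = "bananas (r 1) (r 2) (a 1) (b 1) (c 1) (a 2) (b 2) (c 2)"
  have VE: "?G = (V, E)" using assms(2) by (simp add: double_banana_eq_bananas)
  note G = simple_graph_bananas[OF assms(1), unfolded VE fst_conv snd_conv]
  have part: "\<forall>e\<in>E. \<exists>S1 S2 S3. good_partition (V, E) e S1 S2 S3"
    using good_partition_bananas[OF assms(1)] unfolding VE by simp
  have nr: "\<not> rigid TYPE(3) (V, E)"
    using not_rigid_bananas[OF assms(1)] unfolding VE .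
  then have "\<not> minimally_rigid TYPE(3) (V, E)" by (simp add: minimally_rigid_def)
  moreover have "4 \<le> card V" using G(2) by simp
  ultimately show ?thesis using G part nr by blast
qed

end
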